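(* Let $A,B,C\ge 2$ be integers. Then Pythagoras' equation $A^2+B^2-C^2=0$ holds if and only if $$\sum_{l=2}^{\max(A,B,C)} 2^l\,(a_{Al}+a_{Bl}-a_{Cl}) = 2 + C - A - B.$$
   Context: For an integer $m\ge 2$ let $\psi_m(n) = n + (m-1)(n-1)B_{n-1,m-1}$, where $B_{a,b}=\frac{(a+b)!}{a!\,b!}$, for positive integers $n$; equivalently $\psi_m$ is the polynomial of degree $m$ in $n$ given by $\psi_m(n) = n + \frac{n-1}{(m-2)!}\prod_{j=0}^{m-2}(n+j)$. Its coefficients of $n^0$ and $n^1$ vanish. The rational numbers $a_{mk}$ ($2\le k\le m$) are defined by expanding in powers of $n$: $\psi_m(n)=\sum_{k=2}^m a_{mk}n^k$, and $a_{mk}=0$ for $k>m$. *)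

theory Defs
  imports Complex_Main "HOL-Computational_Algebra.Polynomial"
begin

definition binom_B :: "nat \<Rightarrow> nat \<Rightarrow> rat" where
  "binom_B a b = fact (a + b) / (fact a * fact b)"

text \<open>Natural subtraction is harmless below: the intended range is \<open>m \<ge> 2\<close>, \<open>n \<ge> 1\<close>.\<close>

definition psi :: "nat \<Rightarrow> nat \<Rightarrow> rat" where
  "psi m n = of_nat n + of_nat (m - 1) * of_nat (n - 1) * binom_B (n - 1) (m - 1)"

text \<open>The polynomial \<open>n + (n - 1) / (m - 2)! * (\<Prod>j=0..m-2. n + j)\<close> in the indeterminate \<open>n\<close>.\<close>

definition psi_poly :: "nat \<Rightarrow> rat poly" where
  "psi_poly m = [:0, 1:] + smult (1 / fact (m - 2)) ([:-1, 1:] * (\<Prod>j=0..m-2. [:of_nat j, 1:]))"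

definition a :: "nat \<Rightarrow> nat \<Rightarrow> rat" where
  "a m k = coeff (psi_poly m) k"

lemma poly_psi_poly:
  assumes "m \<ge> 2" "n \<ge> 1"
  shows "poly (psi_poly m) (of_nat n) = psi m n"
proof -
  obtain k where m: "m = k + 2" using assms(1) by (metis add.commute le_Suc_ex)
  obtain l where n: "n = l + 1" using assms(2) by (metis add.commute le_Suc_ex)
  have P: "(\<Prod>j=0..k. (of_nat (l + 1) + of_nat j :: rat)) * fact l = fact (l + k + 1)" for k
  proof (induction k)
    case (Suc k)
    have "(\<Prod>j=0..Suc k. (of_nat (l + 1) + of_nat j :: rat)) * fact l
        = of_nat (l + Suc k + 1) * ((\<Prod>j=0..k. (of_nat (l + 1) + of_nat j)) * fact l)"
      by (simp add: algebra_simps)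
    also have "\<dots> = fact (l + Suc k + 1)"
      unfolding Suc.IH by simp
    finally show ?case .
  qed simp
  have Q: "(\<Prod>j=0..k. (of_nat (l + 1) + of_nat j :: rat)) = fact (l + k + 1) / fact l"
    using P[of k] by (simp add: field_simps)
  have "poly (psi_poly m) (of_nat n)
      = of_nat n + of_nat l * (\<Prod>j=0..k. (of_nat (l + 1) + of_nat j :: rat)) / fact k"
    unfolding psi_poly_def m n by (simp add: poly_prod algebra_simps)
  also have "\<dots> = of_nat n + of_nat l * (fact (l + k + 1) / fact l) / fact k"
    by (simp only: Q)
  also have "\<dots> = psi m n"
  proof -
    have "(fact (k + 1) :: rat) = of_nat (k + 1) * fact k" by simp
    moreover have "(of_nat (k + 1) :: rat) \<noteq> 0" by (simp del: of_nat_Suc of_nat_add)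
    ultimately show ?thesis
      unfolding psi_def binom_B_def m n by (simp add: divide_simps del: fact_Suc of_nat_Suc of_nat_add)
  qed
  finally show ?thesis .
qed

lemma degree_psi_poly_le:
  assumes "m \<ge> 2"
  shows "degree (psi_poly m) \<le> m"
proof -
  have "degree (\<Prod>j=0..m-2. [:of_nat j, 1 :: rat:]) \<le> (\<Sum>j=0..m-2. degree [:of_nat j, 1 :: rat:])"
    using degree_prod_sum_le[of "{0..m-2}" "\<lambda>j. [:of_nat j, 1 :: rat:]"] by (simp add: o_def)
  hence "degree (\<Prod>j=0..m-2. [:of_nat j, 1 :: rat:]) \<le> m - 1"
    using assms by simp
  hence "degree ([:-1, 1:] * (\<Prod>j=0..m-2. [:of_nat j, 1 :: rat:])) \<le> m"
    using degree_mult_le[of "[:-1, 1:]" "\<Prod>j=0..m-2. [:of_nat j, 1 :: rat:]"] assms by simp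
  thus ?thesis
    unfolding psi_poly_def using assms
    by (intro degree_add_le order.trans[OF degree_smult_le]) simp_all
qed

lemma a_eq_0: "m \<ge> 2 \<Longrightarrow> k > m \<Longrightarrow> a m k = 0"
  unfolding a_def using degree_psi_poly_le[of m] by (intro coeff_eq_0) linarith

lemma a_0: "a m 0 = 0"
proof -
  have "poly (\<Prod>j=0..m-2. [:of_nat j, 1 :: rat:]) 0 = 0"
    by (auto simp: poly_prod)
  thus ?thesis
    by (simp add: a_def psi_poly_def poly_0_coeff_0)
qed

lemma a_1: "a m 1 = 0"
proof -
  have E: "(\<Prod>j=0..k. [:of_nat j, 1 :: rat:]) = [:0, 1:] * (\<Prod>j=1..k. [:of_nat j, 1:])" for k
    by (simp add: prod.atLeast_Suc_atMost)
  have F: "coeff (\<Prod>j=1..k. [:of_nat j, 1 :: rat:]) 0 = fact k" for k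
    by (simp add: poly_0_coeff_0[symmetric] poly_prod fact_prod)
  show ?thesis
    unfolding a_def psi_poly_def E using F[of "m - 2"] by simp
qed

end

theory Submission imports Defs begin

text \<open>
  The sum is an evaluation at the base \<open>2\<close>: since \<open>\<psi>\<^sub>m\<close> has no terms of order \<open>0\<close> or \<open>1\<close>,
  the powers of \<open>2\<close> weighted by the \<open>a m l\<close> add up to \<open>\<psi>\<^sub>m(2)\<close>.  At \<open>n = 2\<close> the binomial
  coefficient \<open>B\<close> collapses to \<open>m\<close>, so \<open>\<psi>\<^sub>m(2) = 2 + (m - 1) m\<close> is quadratic in \<open>m\<close> with leading
  coefficient \<open>1\<close>.  Hence the left-hand side of the criterion is
  \<open>(A\<^sup>2 + B\<^sup>2 - C\<^sup>2) + (2 + C - A - B)\<close>, and the criterion says exactly that the first bracket vanishes.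
\<close>

lemma psi_2:
  assumes "m \<ge> 2"
  shows "psi m 2 = (of_nat m)^2 - of_nat m + 2"
proof -
  obtain k where m: "m = Suc k" using assms by (cases m) auto
  have "binom_B 1 k = of_nat (Suc k)"
    by (simp add: binom_B_def)
  thus ?thesis
    by (simp add: psi_def m power2_eq_square algebra_simps)
qed

text \<open>
  The upper summation bound may exceed the degree \<open>m\<close>, which lets the three expansions for
  \<open>A\<close>, \<open>B\<close> and \<open>C\<close> share one range of summation.
\<close>

lemma sum_a_eq_psi:
  assumes "m \<ge> 2" and "m \<le> N" and "n \<ge> 1"
  shows "(\<Sum>l=2..N. of_nat n ^ l * a m l) = psi m n"
proof -
  have "psi m n = (\<Sum>l\<le>degree (psi_poly m). a m l * of_nat n ^ l)"
    using poly_psi_poly[OF assms(1,3)] by (simp add: poly_altdef a_def)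
  also have "\<dots> = (\<Sum>l\<le>N. a m l * of_nat n ^ l)"
    using degree_psi_poly_le[OF assms(1)] assms(2)
    by (intro sum.mono_neutral_left) (auto simp: a_def coeff_eq_0)
  also have "\<dots> = (\<Sum>l=2..N. a m l * of_nat n ^ l)"
  proof (rule sum.mono_neutral_right)
    show "\<forall>l\<in>{..N} - {2..N}. a m l * of_nat n ^ l = 0"
    proof
      fix l assume "l \<in> {..N} - {2..N}"
      hence "l = 0 \<or> l = 1" by auto
      thus "a m l * of_nat n ^ l = 0" using a_0 a_1 by auto
    qed
  qed auto
  finally show ?thesis by (simp add: mult.commute)
qed

theorem mainTheorem7:
  fixes A B C :: nat
  assumes "A \<ge> 2" and "B \<ge> 2" and "C \<ge> 2"
  shows "(int A)^2 + (int B)^2 - (int C)^2 = 0 \<longleftrightarrow>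
    (\<Sum>l=2..Max {A, B, C}. 2 ^ l * (a A l + a B l - a C l))
      = 2 + of_nat C - of_nat A - of_nat B"
proof -
  let ?N = "Max {A, B, C}"
  have eval: "(\<Sum>l=2..?N. 2 ^ l * a m l) = (of_nat m)^2 - of_nat m + 2"
    if "m \<ge> 2" "m \<in> {A, B, C}" for m
  proof -
    have "m \<le> ?N" by (rule Max_ge) (use that(2) in simp_all)
    thus ?thesis using sum_a_eq_psi[of m ?N 2] psi_2[of m] that(1) by simp
  qed
  have "(\<Sum>l=2..?N. 2 ^ l * (a A l + a B l - a C l))
      = (\<Sum>l=2..?N. 2 ^ l * a A l) + (\<Sum>l=2..?N. 2 ^ l * a B l) - (\<Sum>l=2..?N. 2 ^ l * a C l)"
    by (simp only: distrib_left right_diff_distrib sum.distrib sum_subtractf)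
  also have "\<dots> = of_int ((int A)^2 + (int B)^2 - (int C)^2)
      + (2 + of_nat C - of_nat A - of_nat B)"
    using eval[of A] eval[of B] eval[of C] assms by simp
  finally have "(\<Sum>l=2..?N. 2 ^ l * (a A l + a B l - a C l))
      = of_int ((int A)^2 + (int B)^2 - (int C)^2) + (2 + of_nat C - of_nat A - of_nat B)" .
  thus ?thesis
    by (simp only: add_cancel_left_left of_int_eq_0_iff)
qed

end
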